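(* Let $1<r\leq 2$. The range $\{s_{-r}(n):n\in\mathbb{N}\}$ of $s_{-r}$ is dense in the interval $\left(\frac{1}{\zeta(r)},1\right]$ if and only if $s_{-r}(p_m^2)\geq\prod_{i=m+1}^{\infty}s_{-r}(p_i)$ for all $m\in\{1,2,4\}$.
   Context: For a real number $t$, $s_t$ denotes the multiplicative arithmetic function defined by $s_t(p^{\alpha})=\sum_{j=0}^{\alpha}(-p^t)^j$ for all primes $p$ and positive integers $\alpha$. $p_i$ denotes the $i$-th prime number and $\zeta$ is the Riemann zeta function. *)

theory Defs
  imports "HOL-Analysis.Analysis" "HOL-Computational_Algebra.Computational_Algebra"
begin

(* The multiplicative function s_t, given by its values on prime powers; the three lemmas
   after the definition are the properties that determine it on positive integers. *)
definition s :: "real \<Rightarrow> nat \<Rightarrow> real" where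
  "s t n = (\<Prod>p\<in>prime_factors n. \<Sum>j=0..multiplicity p n. (- (real p powr t)) ^ j)"

lemma s_1: "s t 1 = 1"
  by (simp add: s_def)

lemma s_prime_power:
  assumes "prime p" "\<alpha> > 0"
  shows "s t (p ^ \<alpha>) = (\<Sum>j=0..\<alpha>. (- (real p powr t)) ^ j)"
  using assms by (simp add: s_def prime_factorization_prime_power)

lemma s_mult_coprime:
  fixes m n :: nat
  assumes "m > 0" "n > 0" "coprime m n"
  shows "s t (m * n) = s t m * s t n"
proof -
  have disj: "prime_factors m \<inter> prime_factors n = {}"
    using assms(3) by (metis (no_types, lifting) coprime_common_divisor disjoint_iff
        in_prime_factors_imp_dvd in_prime_factors_imp_prime not_prime_unit)
  have mult: "multiplicity p (m * n) = multiplicity p m + multiplicity p n" if "prime p" for p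
    using that assms by (intro prime_elem_multiplicity_mult_distrib) auto
  have zero: "multiplicity p k = 0" if "prime p" "k > 0" "p \<notin> prime_factors k" for p k :: nat
    using that by (auto simp: prime_factors_dvd intro: not_dvd_imp_multiplicity_0)
  have A: "(\<Prod>p\<in>prime_factors m. \<Sum>j=0..multiplicity p (m * n). (- (real p powr t)) ^ j) = s t m"
    unfolding s_def
  proof (rule prod.cong)
    fix p assume p: "p \<in> prime_factors m"
    then have "prime p" "p \<notin> prime_factors n" using disj by auto
    then show "(\<Sum>j=0..multiplicity p (m * n). (- (real p powr t)) ^ j)
             = (\<Sum>j=0..multiplicity p m. (- (real p powr t)) ^ j)"
      using mult zero assms by simp
  qed simp
  have B: "(\<Prod>p\<in>prime_factors n. \<Sum>j=0..multiplicity p (m * n). (- (real p powr t)) ^ j) = s t n"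
    unfolding s_def
  proof (rule prod.cong)
    fix p assume p: "p \<in> prime_factors n"
    then have "prime p" "p \<notin> prime_factors m" using disj by auto
    then show "(\<Sum>j=0..multiplicity p (m * n). (- (real p powr t)) ^ j)
             = (\<Sum>j=0..multiplicity p n. (- (real p powr t)) ^ j)"
      using mult zero assms by simp
  qed simp
  have "s t (m * n) = (\<Prod>p\<in>prime_factors m \<union> prime_factors n.
      \<Sum>j=0..multiplicity p (m * n). (- (real p powr t)) ^ j)"
    using assms by (simp add: s_def prime_factors_product)
  also have "\<dots> = s t m * s t n"
    using disj A B by (subst prod.union_disjoint) auto
  finally show ?thesis .
qed

(* Indexed from 1, so that nth_prime 1 = 2; the value at 0 is immaterial. *)
definition nth_prime :: "nat \<Rightarrow> nat" where
  "nth_prime i = enumerate {p. prime p} (i - 1)"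

(* The Riemann zeta function on real arguments greater than 1, where its Dirichlet series
   converges; for other arguments the value carries no meaning. *)
definition zeta :: "real \<Rightarrow> real" where
  "zeta x = (\<Sum>n. 1 / real (Suc n) powr x)"

end

theory Submission
  imports Defs
begin

text \<open>Write \<open>x\<^sub>p = p\<^bsup>-r\<^esup>\<close> and pass to \<open>- ln\<close>. The values of \<open>s\<close> become sums over the primes
  of digits, where the digit at \<open>p\<close> is \<open>0\<close> or lies between \<open>v\<^sub>p = - ln (1 - x\<^sub>p + x\<^sub>p\<^sup>2)\<close> and
  \<open>u\<^sub>p = - ln (1 - x\<^sub>p)\<close>; let \<open>T\<^sub>p\<close> be the sum of \<open>u\<^sub>q\<close> over the primes \<open>q > p\<close>.
  By the Euler product, \<open>ln (zeta r)\<close> is the sum of all \<open>u\<^sub>q\<close>.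
  As \<open>v\<^sub>p\<close> decreases in \<open>p\<close>, no value of \<open>- ln s\<close> lies strictly between \<open>T\<^sub>p\<close> and \<open>v\<^sub>p\<close>. Conversely,
  if \<open>v\<^sub>p \<le> T\<^sub>p\<close> for all \<open>p\<close>, a greedy choice of digits approximates every target.
  So density is equivalent to \<open>v\<^sub>p \<le> T\<^sub>p\<close> for all primes \<open>p\<close>, that is, to the stated inequality at
  all \<open>m\<close>. For \<open>p\<close> outside \<open>{2, 3, 7}\<close> it holds automatically, because \<open>v\<^sub>p \<le> x\<^sub>p\<close>
  and there are finitely many primes \<open>q > p\<close> such that the sum of \<open>(p / q)\<^sup>2\<close> is at least \<open>1\<close>:
  for \<open>11 \<le> p < 1024\<close> two primes below about \<open>p \<surd>2\<close> suffice, and for larger \<open>p\<close> one uses a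
  Chebyshev bound derived from \<open>2\<^bsup>n\<^esup> \<le> lcm(1, \<dots>, n + 1)\<close>.\<close>

section \<open>Primes above a given prime\<close>

text \<open>For positive \<open>d\<close>, \<open>d dvd L\<close> says that 1/d is an integer
  multiple of 1/L. Such multiples are closed under differences, and each entry of column
  \<open>Suc k\<close> of Leibniz' harmonic triangle is a difference of two entries of column
  \<open>k\<close>.\<close>

lemma Lcm_dvd_Suc_mult_binomial:
  assumes "k \<le> n"
  shows "Suc n * (n choose k) dvd Lcm {1..Suc n}"
  using assms
proof (induction k arbitrary: n)
  case 0
  then show ?case by (auto intro: dvd_Lcm)
next
  case (Suc k)
  then obtain m where n: "n = Suc m" and km: "k \<le> m"
    by (cases n) auto
  define L where "L = Lcm {1..Suc n}"
  have "Lcm {1..n} dvd L"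
    unfolding L_def by (rule Lcm_subset) auto
  with Suc.IH[OF km] have "Suc m * (m choose k) dvd L"
    unfolding n by (rule dvd_trans)
  then obtain a where a: "L = Suc m * (m choose k) * a" ..
  have "Suc n * (n choose k) dvd L"
    using Suc.IH[of n] Suc.prems unfolding L_def by simp
  then obtain b where b: "L = Suc n * (n choose k) * b" ..
  \<comment> \<open>Over the integers the quotient \<open>a - b\<close> is not truncated.\<close>
  define A where "A = int (m choose k)"
  define B where "B = int (n choose k)"
  define C where "C = int (n choose Suc k)"
  have AB: "(int n - int k) * B = int n * A"
    using binomial_absorb_comp[of n k] km unfolding A_def B_def n
    by (metis Suc_leD diff_Suc_1 le_SucI of_nat_diff of_nat_mult)
  have AC: "(int k + 1) * C = int n * A"
    using Suc_times_binomial[of k m] unfolding A_def C_def n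
    by (metis of_nat_Suc of_nat_mult add.commute)
  have nA: "int n * A > 0"
    using km unfolding A_def n by simp
  have La: "int L = int n * A * int a"
    using a unfolding A_def n by (metis of_nat_mult)
  have Lb: "int L = (int n + 1) * B * int b"
    using b unfolding B_def by (metis of_nat_Suc of_nat_mult add.commute)
  \<comment> \<open>Leibniz' harmonic triangle: \<open>1 / (n A) - 1 / ((n + 1) B) = 1 / ((n + 1) C)\<close>.\<close>
  have "int n * A * int L = int n * A * ((int n + 1) * C * (int a - int b))"
  proof -
    have "(int n + 1) * C * (int n * A * int a) - C * (int n * A * ((int n + 1) * int b))
        = (int n + 1) * C * int L - C * (int n - int k) * int L"
      using La Lb AB by algebra
    also have "\<dots> = int n * A * int L"
      using AC by algebra
    finally show ?thesis by (simp add: algebra_simps)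
  qed
  with nA have "int L = (int n + 1) * C * (int a - int b)"
    by (metis less_irrefl mult_left_cancel)
  then have "int (Suc n * (n choose Suc k)) dvd int L"
    unfolding C_def by (metis dvd_triv_left of_nat_Suc of_nat_mult add.commute)
  then show ?case unfolding L_def by (simp only: of_nat_dvd_iff)
qed

text \<open>Each \<open>Suc n * (n choose k)\<close> divides the lcm, so their average
  \<open>2 ^ n\<close> over \<open>k\<close> does not exceed it.\<close>

lemma power2_le_Lcm: "2 ^ n \<le> Lcm {1..Suc n}"
proof -
  have L: "Lcm {1..Suc n} > 0"
    by (intro Nat.gr0I) (simp add: Lcm_0_iff)
  have "Suc n * 2 ^ n = (\<Sum>k\<le>n. Suc n * (n choose k))"
    by (simp only: choose_row_sum flip: sum_distrib_left)
  also have "\<dots> \<le> (\<Sum>k\<le>n. Lcm {1..Suc n})"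
  proof (rule sum_mono)
    fix k assume "k \<in> {..n}"
    then show "Suc n * (n choose k) \<le> Lcm {1..Suc n}"
      using dvd_imp_le[OF Lcm_dvd_Suc_mult_binomial L] by simp
  qed
  also have "\<dots> = Suc n * Lcm {1..Suc n}"
    by simp
  finally show ?thesis by (simp only: mult_le_cancel1)
qed

lemma prime_power_dvd_Lcm_finite:
  fixes A :: "nat set"
  assumes "finite A" "0 \<notin> A" "prime p" "p ^ k dvd Lcm A" "k > 0"
  shows "\<exists>a\<in>A. p ^ k dvd a"
  using assms
proof (induction A rule: finite_induct)
  case empty
  then show ?case by (auto simp: prime_nat_iff)
next
  case (insert a A)
  have "Lcm A \<noteq> 0" "a \<noteq> 0" using insert by (auto simp: Lcm_0_iff)
  with insert.prems have "p ^ k dvd a \<or> p ^ k dvd Lcm A"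
    by (simp add: power_dvd_iff_le_multiplicity multiplicity_lcm le_max_iff_disj
        lcm_eq_0_iff prime_elem_not_unit del: One_nat_def)
  then show ?case using insert by auto
qed

definition primepi :: "nat \<Rightarrow> nat" where
  "primepi n = card {p. prime p \<and> p \<le> n}"

text \<open>The \<open>p\<close>-part of the lcm divides one of the numbers up to \<open>n\<close>,
  hence is at most \<open>n\<close>; there is at most one such factor for each prime up to
  \<open>n\<close>.\<close>

lemma Lcm_le_power_primepi:
  assumes "n > 0"
  shows "Lcm {1..n} \<le> n ^ primepi n"
proof -
  let ?L = "Lcm {1..n}"
  have L: "?L \<noteq> 0" by (simp add: Lcm_0_iff)
  have fin: "finite {p. prime p \<and> p \<le> n}" by simp
  have le: "p ^ multiplicity p ?L \<le> n" if "p \<in> prime_factors ?L" for p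
  proof -
    have p: "prime p" "multiplicity p ?L > 0"
      using that L by (auto simp: prime_factors_multiplicity)
    obtain a where "a \<in> {1..n}" "p ^ multiplicity p ?L dvd a"
      using prime_power_dvd_Lcm_finite[of "{1..n}" p "multiplicity p ?L"] p
      by (auto simp: multiplicity_dvd)
    then show ?thesis by (meson atLeastAtMost_iff dvd_imp_le le_trans less_le_trans zero_less_one)
  qed
  have sub: "prime_factors ?L \<subseteq> {p. prime p \<and> p \<le> n}"
  proof
    fix p assume p: "p \<in> prime_factors ?L"
    then have "multiplicity p ?L > 0" "prime p"
      by (auto simp: prime_factors_multiplicity)
    then have "p ^ 1 \<le> p ^ multiplicity p ?L"
      by (intro power_increasing) (auto simp: prime_gt_0_nat Suc_leI)
    with le[OF p] \<open>prime p\<close> show "p \<in> {p. prime p \<and> p \<le> n}" by simp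
  qed
  have "?L = (\<Prod>p\<in>prime_factors ?L. p ^ multiplicity p ?L)"
    using L by (intro prime_factorization_nat) (simp only: neq0_conv)
  also have "\<dots> \<le> (\<Prod>p\<in>prime_factors ?L. n)"
    by (intro prod_mono conjI le) simp_all
  also have "\<dots> \<le> n ^ primepi n"
    unfolding primepi_def using assms fin sub
    by (auto intro!: power_increasing card_mono)
  finally show ?thesis .
qed

text \<open>Halving \<open>p + 1\<close> is injective on primes: 2 goes to 1, and the odd primes go
  to distinct numbers from 2 on.\<close>

lemma two_primepi_le: "2 * primepi n \<le> n + 1"
proof -
  have inj: "inj_on (\<lambda>p. (p + 1) div 2) {p. prime p \<and> p \<le> n}"
  proof (rule inj_onI)
    fix p q :: nat
    assume pq: "p \<in> {p. prime p \<and> p \<le> n}" "q \<in> {p. prime p \<and> p \<le> n}"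
      and eq: "(p + 1) div 2 = (q + 1) div 2"
    have "p = 2 \<or> odd p" "q = 2 \<or> odd q" "p \<ge> 2" "q \<ge> 2"
      using pq by (auto simp: prime_ge_2_nat prime_odd_nat dest: primes_dvd_imp_eq[OF two_is_prime_nat])
    with eq show "p = q" by presburger
  qed
  have "primepi n \<le> card {1..(n + 1) div 2}"
    unfolding primepi_def
  proof (rule card_inj_on_le[OF inj])
    have "1 \<le> (p + 1) div 2 \<and> (p + 1) div 2 \<le> (n + 1) div 2" if "prime p" "p \<le> n" for p
      using prime_ge_2_nat[OF that(1)] that(2) by (simp add: div_le_mono)
    then show "(\<lambda>p. (p + 1) div 2) ` {p. prime p \<and> p \<le> n} \<subseteq> {1..(n + 1) div 2}"
      by auto
  qed simp
  then show ?thesis by simp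
qed

text \<open>Since \<open>L\<^sup>2 \<le> 2\<^bsup>L-2\<^esup>\<close>, one has \<open>(L p)\<^sup>2 \<le> 2\<^bsup>3L\<^esup>\<close>, so that
  \<open>2\<^bsup>L p - 1\<^esup> \<le> (L p)\<^bsup>\<pi>(L p)\<^esup>\<close> gives \<open>\<pi>(L p) \<ge> 2 p / 3\<close>.\<close>

lemma many_primes_above:
  assumes "2 ^ L \<le> p" "p < 2 ^ Suc L" "L \<ge> 10"
  shows "L\<^sup>2 \<le> card {q. prime q \<and> p < q \<and> q \<le> L * p}"
proof -
  \<comment> \<open>The first bound makes \<open>2 * p / 3 - (p + 1) / 2 \<ge> L\<^sup>2\<close> in
    the final count; the second gives \<open>(L * p)\<^sup>2 \<le> 2 ^ (3 * L)\<close>.\<close>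
  have "6 * L\<^sup>2 + 3 \<le> 2 ^ L \<and> 4 * L\<^sup>2 \<le> 2 ^ L"
    using \<open>L \<ge> 10\<close>
  proof (induction L rule: dec_induct)
    case (step k)
    have "10 * k \<le> k\<^sup>2" using step by (simp add: power2_eq_square)
    moreover have "(Suc k)\<^sup>2 = k\<^sup>2 + 2 * k + 1" by (simp add: power2_eq_square)
    ultimately have "(Suc k)\<^sup>2 \<le> 2 * k\<^sup>2" using step by linarith
    then show ?case using step by simp
  qed simp
  then have L1: "6 * L\<^sup>2 + 3 \<le> 2 ^ L" and L2: "4 * L\<^sup>2 \<le> 2 ^ L" by auto
  define N where "N = L * p"
  have "(4::nat) * N\<^sup>2 \<le> 2 ^ L * p\<^sup>2"
    using mult_right_mono[OF L2, of "p\<^sup>2"] by (simp add: N_def power_mult_distrib)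
  also have "\<dots> \<le> 2 ^ L * (2 ^ Suc L)\<^sup>2"
    using assms(2) by (intro mult_left_mono power_mono) auto
  also have "\<dots> = 4 * 2 ^ (3 * L)"
    by (simp add: power2_eq_square flip: power_add)
  finally have N2: "N\<^sup>2 \<le> 2 ^ (3 * L)" by simp
  have "p > 0" using assms(1) by (metis gr0I not_le zero_less_numeral zero_less_power)
  then have "N > 0" using assms(3) by (simp add: N_def)
  then obtain M where M: "N = Suc M" by (cases N) auto
  have "(2::nat) ^ M \<le> N ^ primepi N"
    using power2_le_Lcm[of M] Lcm_le_power_primepi[of N] M by simp
  then have "(2 ^ M)\<^sup>2 \<le> (N ^ primepi N)\<^sup>2" by (rule power_mono) simp
  also have "\<dots> = (N\<^sup>2) ^ primepi N" by (simp add: mult.commute flip: power_mult)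
  also have "\<dots> \<le> (2 ^ (3 * L)) ^ primepi N" using N2 by (rule power_mono) simp
  finally have "(2::nat) ^ (2 * M) \<le> 2 ^ (3 * L * primepi N)"
    by (simp add: mult.commute flip: power_mult)
  then have "2 * M \<le> 3 * L * primepi N" by (rule power_le_imp_le_exp[rotated]) simp
  then have "2 * (L * p) \<le> 3 * L * primepi N + 2" using M unfolding N_def by simp
  \<comment> \<open>The 2 lost through \<open>M = N - 1\<close> is less than \<open>L\<close>, so
    \<open>L\<close> cancels.\<close>
  then have "L * (2 * p) < L * (3 * primepi N + 1)" using \<open>L \<ge> 10\<close> by (simp add: algebra_simps)
  then have lower: "2 * p < 3 * primepi N + 1" by (simp only: mult_less_cancel1)
  have "p \<le> N" using \<open>L \<ge> 10\<close> by (simp add: N_def)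
  then have "{q. prime q \<and> q \<le> N} = {q. prime q \<and> q \<le> p} \<union> {q. prime q \<and> p < q \<and> q \<le> N}"
    by auto
  then have "primepi N = primepi p + card {q. prime q \<and> p < q \<and> q \<le> N}"
    unfolding primepi_def by (subst card_Un_disjoint[symmetric]) auto
  then show ?thesis
    using lower two_primepi_le[of p] L1 assms(1) unfolding N_def by linarith
qed

text \<open>Trial division: a composite number below \<open>k\<^sup>2\<close> has a divisor other
  than 1 below \<open>k\<close>. The explicit list lets \<open>simp\<close> certify primes up to
  1033 with \<open>k = 33\<close>.\<close>

lemma prime_natI_below_square:
  fixes n k :: nat
  assumes "1 < n" "n < k\<^sup>2" "\<forall>m\<in>set [2..<k]. m dvd n \<longrightarrow> m = n"
  shows "prime n"
proof (rule ccontr)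
  assume "\<not> prime n"
  then obtain a where a: "a dvd n" "a \<noteq> 1" "a \<noteq> n"
    using assms(1) by (auto simp: prime_nat_iff)
  then obtain b where b: "n = a * b" by blast
  have pos: "a \<noteq> 0" "b \<noteq> 0" "b \<noteq> 1" using a b assms(1) by (auto intro: Nat.gr0I)
  have "a < k \<or> b < k"
  proof (rule ccontr)
    assume "\<not> (a < k \<or> b < k)"
    then have "k * k \<le> a * b" by (intro mult_le_mono) auto
    with assms(2) b show False by (simp add: power2_eq_square)
  qed
  then have "a \<in> set [2..<k] \<or> b \<in> set [2..<k]" using a pos by auto
  moreover have "a dvd n" "b dvd n" unfolding b by simp_all
  ultimately have "a = n \<or> b = n" using assms(3) by blast
  then have "b = n" using a(3) by blast
  with b have "a * b = 1 * b" by (metis mult_1)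
  with a(2) pos(2) mult_right_cancel[of b a 1] show False by blast
qed

text \<open>The last hypothesis is \<open>(a/b)\<^sup>2 + (a/c)\<^sup>2 \<ge> 1\<close> cleared of
  denominators: one numerical check at the left end \<open>a\<close> settles every \<open>p\<close>
  in the block.\<close>

lemma prime_squares_block:
  fixes p a b c :: nat
  assumes "a \<le> p" "p < b" "b < c" "prime b" "prime c" "b\<^sup>2 * c\<^sup>2 \<le> a\<^sup>2 * (b\<^sup>2 + c\<^sup>2)"
  shows "\<exists>Q. finite Q \<and> (\<forall>q\<in>Q. prime q \<and> p < q) \<and> (\<Sum>q\<in>Q. (real p / real q)\<^sup>2) \<ge> 1"
proof (intro exI conjI)
  have pos: "real b > 0" "real c > 0" using assms by auto
  have "real (b\<^sup>2 * c\<^sup>2) \<le> real (a\<^sup>2 * (b\<^sup>2 + c\<^sup>2))"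
    using assms(6) by (simp only: of_nat_le_iff)
  also have "\<dots> \<le> (real p)\<^sup>2 * ((real b)\<^sup>2 + (real c)\<^sup>2)"
    using assms(1) by (simp add: mult_right_mono)
  finally have "1 \<le> (real p / real b)\<^sup>2 + (real p / real c)\<^sup>2"
    using pos by (simp add: field_simps)
  then show "1 \<le> (\<Sum>q\<in>{b, c}. (real p / real q)\<^sup>2)" using assms by simp
  show "\<forall>q\<in>{b, c}. prime q \<and> p < q" using assms by auto
qed simp

lemma sum_prime_squares_above:
  fixes p :: nat
  assumes "p = 5 \<or> p \<ge> 11"
  shows "\<exists>Q. finite Q \<and> (\<forall>q\<in>Q. prime q \<and> p < q) \<and> (\<Sum>q\<in>Q. (real p / real q)\<^sup>2) \<ge> 1"
proof -
  consider "p = 5" | "11 \<le> p" "p < 1024" | "1024 \<le> p" using assms by linarith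
  then show ?thesis
  proof cases
    case 1
    \<comment> \<open>The next two primes alone are too few here:
      \<open>25/49 + 25/121 < 1\<close>.\<close>
    have "(\<Sum>q\<in>{7, 11, 13, 17, 19, 23}. (real p / real q)\<^sup>2) \<ge> 1"
      by (simp add: 1 power2_eq_square)
    moreover have "\<forall>q\<in>{7, 11, 13, 17, 19, 23}. prime q \<and> p < q" by (simp add: 1)
    ultimately show ?thesis by (intro exI[of _ "{7, 11, 13, 17, 19, 23}"]) simp
  next
    case 2
    have large_primes:
      "prime (149::nat)" "prime (151::nat)" "prime (199::nat)" "prime (211::nat)" "prime (277::nat)"
      "prime (281::nat)" "prime (383::nat)" "prime (389::nat)" "prime (523::nat)" "prime (541::nat)"
      "prime (733::nat)" "prime (739::nat)" "prime (1031::nat)" "prime (1033::nat)"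
      by (rule prime_natI_below_square[where k = 33]; simp)+
    \<comment> \<open>Each block ends at a prime \<open>b\<close>, where the next one begins, and
      \<open>c\<close> is the prime after \<open>b\<close>. The last block ends at 1031, the first
      prime above 1024.\<close>
    from 2 have "11 \<le> p" "p < 1031" by simp_all
    then consider "11 \<le> p" "p < 13" | "13 \<le> p" "p < 17" | "17 \<le> p" "p < 19" | "19 \<le> p" "p < 23"
      | "23 \<le> p" "p < 29" | "29 \<le> p" "p < 37" | "37 \<le> p" "p < 47" | "47 \<le> p" "p < 61"
      | "61 \<le> p" "p < 83" | "83 \<le> p" "p < 109" | "109 \<le> p" "p < 149" | "149 \<le> p" "p < 199"
      | "199 \<le> p" "p < 277" | "277 \<le> p" "p < 383" | "383 \<le> p" "p < 523" | "523 \<le> p" "p < 733"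
      | "733 \<le> p" "p < 1031"
      by (meson not_le)
    then show ?thesis
    proof cases
      case 1 then show ?thesis by (rule prime_squares_block[where c = 17]) simp_all
    next
      case 2 then show ?thesis by (rule prime_squares_block[where c = 19]) simp_all
    next
      case 3 then show ?thesis by (rule prime_squares_block[where c = 23]) simp_all
    next
      case 4 then show ?thesis by (rule prime_squares_block[where c = 29]) simp_all
    next
      case 5 then show ?thesis by (rule prime_squares_block[where c = 31]) simp_all
    next
      case 6 then show ?thesis by (rule prime_squares_block[where c = 41]) simp_all
    next
      case 7 then show ?thesis by (rule prime_squares_block[where c = 53]) simp_all
    next
      case 8 then show ?thesis by (rule prime_squares_block[where c = 67]) simp_all
    next
      case 9 then show ?thesis by (rule prime_squares_block[where c = 89]) simp_all
    next
      case 10 then show ?thesis by (rule prime_squares_block[where c = 113]) simp_all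
    next
      case 11 then show ?thesis by (rule prime_squares_block[where c = 151]) (rule large_primes | simp)+
    next
      case 12 then show ?thesis by (rule prime_squares_block[where c = 211]) (rule large_primes | simp)+
    next
      case 13 then show ?thesis by (rule prime_squares_block[where c = 281]) (rule large_primes | simp)+
    next
      case 14 then show ?thesis by (rule prime_squares_block[where c = 389]) (rule large_primes | simp)+
    next
      case 15 then show ?thesis by (rule prime_squares_block[where c = 541]) (rule large_primes | simp)+
    next
      case 16 then show ?thesis by (rule prime_squares_block[where c = 739]) (rule large_primes | simp)+
    next
      case 17 then show ?thesis by (rule prime_squares_block[where c = 1033]) (rule large_primes | simp)+
    qed
  next
    case 3
    obtain L where L: "2 ^ L \<le> p" "p < 2 ^ Suc L"
      using ex_power_ivl1[of 2 p] 3 by auto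
    have "(2::nat) ^ 10 < 2 ^ Suc L" using L 3 by simp
    then have "L \<ge> 10" by (simp only: power_strict_increasing_iff)
    \<comment> \<open>With \<open>L\<close> the integer part of the binary logarithm of
      \<open>p\<close>, at least \<open>L\<^sup>2\<close> primes in \<open>Q\<close> contribute at
      least \<open>1 / L\<^sup>2\<close> each.\<close>
    define Q where "Q = {q. prime q \<and> p < q \<and> q \<le> L * p}"
    have "1 = real (L\<^sup>2) * (1 / real L)\<^sup>2" using \<open>L \<ge> 10\<close> by (simp add: field_simps)
    also have "\<dots> \<le> real (card Q) * (1 / real L)\<^sup>2"
      using many_primes_above[OF L \<open>L \<ge> 10\<close>] unfolding Q_def by (intro mult_right_mono) simp_all
    also have "\<dots> = (\<Sum>q\<in>Q. (1 / real L)\<^sup>2)" by simp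
    also have "\<dots> \<le> (\<Sum>q\<in>Q. (real p / real q)\<^sup>2)"
    proof (intro sum_mono power_mono)
      fix q assume "q \<in> Q"
      then have "q > 0" "real q \<le> real L * real p"
        by (auto simp: Q_def simp flip: of_nat_mult)
      then show "1 / real L \<le> real p / real q" using \<open>L \<ge> 10\<close> by (simp add: field_simps)
    qed simp
    finally show ?thesis by (intro exI[of _ Q]) (auto simp: Q_def)
  qed
qed

section \<open>Tails of the logarithmic Euler product\<close>

text \<open>This is u_p, continued by 0 off the primes so that sums over primes become ordinary
  series.\<close>

definition prime_log :: "real \<Rightarrow> nat \<Rightarrow> real" where
  "prime_log r n = (if prime n then - ln (1 - real n powr - r) else 0)"

text \<open>\<open>log_tail r (Suc p)\<close> is T_p, and \<open>log_tail r 0\<close> will turn out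
  to be \<open>ln (zeta r)\<close>.\<close>

definition log_tail :: "real \<Rightarrow> nat \<Rightarrow> real" where
  "log_tail r k = (\<Sum>n. prime_log r (n + k))"

lemma prime_powr_bounds:
  assumes "1 < r" "prime p"
  shows "0 < real p powr - r" "real p powr - r < 1 / 2"
proof -
  have p: "2 \<le> real p" using prime_ge_2_nat[OF assms(2)] by simp
  then show "0 < real p powr - r" by simp
  have "real p powr - r < real p powr - 1"
    using p assms(1) by (intro powr_less_mono) auto
  also have "\<dots> \<le> 1 / 2" using p by (simp add: powr_minus_divide field_simps)
  finally show "real p powr - r < 1 / 2" .
qed

lemma exp_neg_prime_log:
  assumes "1 < r" "prime p"
  shows "exp (- prime_log r p) = 1 - real p powr - r"
  using prime_powr_bounds[OF assms] assms(2) by (simp add: prime_log_def)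

lemma prime_log_ge:
  assumes "1 < r" "prime p"
  shows "real p powr - r \<le> prime_log r p"
  using ln_le_minus_one[of "1 - real p powr - r"] prime_powr_bounds[OF assms] assms(2)
  by (simp add: prime_log_def)

lemma prime_log_pos:
  assumes "1 < r" "prime p"
  shows "0 < prime_log r p"
  using prime_log_ge[OF assms] prime_powr_bounds(1)[OF assms] by linarith

lemma prime_log_nonneg:
  assumes "1 < r"
  shows "0 \<le> prime_log r n"
  using prime_log_pos[OF assms, of n] by (cases "prime n") (auto simp: prime_log_def)

lemma summable_powr_neg:
  assumes "(1 :: real) < r"
  shows "summable (\<lambda>n. real n powr - r)"
  using assms by (simp add: summable_real_powr_iff)

lemma summable_prime_log:
  assumes "1 < r"
  shows "summable (prime_log r)"
proof (rule summable_comparison_test')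
  show "summable (\<lambda>n. 2 * real n powr - r)"
    using summable_powr_neg[OF assms] by (rule summable_mult)
  show "norm (prime_log r n) \<le> 2 * real n powr - r" if "n \<ge> 0" for n
  proof (cases "prime n")
    case True
    define x where "x = real n powr - r"
    have x: "0 < x" "x < 1 / 2"
      using prime_powr_bounds[OF assms True] by (auto simp: x_def)
    have "prime_log r n = ln (1 / (1 - x))"
      using True x by (simp add: prime_log_def x_def ln_div)
    also have "\<dots> \<le> 1 / (1 - x) - 1" using x by (intro ln_le_minus_one) simp
    also have "\<dots> \<le> 2 * x" using x by (simp add: field_simps)
    finally show ?thesis using prime_log_nonneg[OF assms, of n] by (simp add: x_def)
  qed (simp add: prime_log_def)
qed

lemma log_tail_eq:
  assumes "1 < r"
  shows "log_tail r k = log_tail r 0 - (\<Sum>n<k. prime_log r n)"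
  using suminf_split_initial_segment[OF summable_prime_log[OF assms], of k]
  by (simp add: log_tail_def)

lemma log_tail_Suc:
  assumes "1 < r"
  shows "log_tail r k = prime_log r k + log_tail r (Suc k)"
  using log_tail_eq[OF assms, of k] log_tail_eq[OF assms, of "Suc k"] by simp

lemma log_tail_tendsto_0:
  assumes "1 < r"
  shows "log_tail r \<longlonglongrightarrow> 0"
  using suminf_exist_split2[OF summable_prime_log[OF assms]]
  by (simp add: log_tail_def[abs_def])

lemma sum_prime_log_le_log_tail:
  assumes "1 < r" "finite Q" "\<And>q. q \<in> Q \<Longrightarrow> k \<le> q"
  shows "(\<Sum>q\<in>Q. prime_log r q) \<le> log_tail r k"
proof -
  have "(\<Sum>q\<in>Q. prime_log r q) = (\<Sum>n\<in>(\<lambda>q. q - k) ` Q. prime_log r (n + k))"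
    using assms(3) by (subst sum.reindex) (auto simp: inj_on_def eq_diff_iff)
  also have "\<dots> \<le> log_tail r k"
    unfolding log_tail_def using assms prime_log_nonneg
    by (intro sum_le_suminf) (auto simp: summable_iff_shift summable_prime_log)
  finally show ?thesis .
qed

lemma log_tail_nonneg:
  assumes "1 < r"
  shows "0 \<le> log_tail r k"
  using sum_prime_log_le_log_tail[OF assms, of "{}" k] by simp

text \<open>The positive term at \<open>p\<close> is left out. Strictness ensures that a gap has a
  part above \<open>1 / zeta r\<close>.\<close>

lemma log_tail_less:
  assumes "1 < r" "prime p"
  shows "log_tail r (Suc p) < log_tail r 0"
  using sum_prime_log_le_log_tail[OF assms(1), of "{..<p}" 0] prime_log_pos[OF assms]
    log_tail_eq[OF assms(1), of "Suc p"] sum_nonneg[of "{..<p}" "prime_log r"]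
    prime_log_nonneg[OF assms(1)]
  by simp

section \<open>The Euler product\<close>

text \<open>What Euler's sieve leaves after the primes below \<open>k\<close>; 1 survives at every
  stage.\<close>

definition rough_numbers :: "nat \<Rightarrow> nat set" where
  "rough_numbers k = {n. n > 0 \<and> (\<forall>q<k. prime q \<longrightarrow> \<not> q dvd n)}"

lemma rough_numbers_Suc:
  assumes "prime k"
  shows "rough_numbers k = rough_numbers (Suc k) \<union> (*) k ` rough_numbers k"
    and "rough_numbers (Suc k) \<inter> (*) k ` rough_numbers k = {}"
proof -
  have *: "k * m \<in> rough_numbers k" if "m \<in> rough_numbers k" for m
    using that assms prime_gt_0_nat[OF assms]
    by (auto simp: rough_numbers_def prime_dvd_mult_iff dest: primes_dvd_imp_eq)
  have "n \<in> (*) k ` rough_numbers k" if "n \<in> rough_numbers k" "n \<notin> rough_numbers (Suc k)" for n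
  proof -
    from that have "k dvd n" by (auto simp: rough_numbers_def less_Suc_eq)
    then obtain m where "n = k * m" ..
    with that(1) show ?thesis by (auto simp: rough_numbers_def intro!: image_eqI[of _ _ m])
  qed
  with * show "rough_numbers k = rough_numbers (Suc k) \<union> (*) k ` rough_numbers k"
    by (auto simp: rough_numbers_def)
  show "rough_numbers (Suc k) \<inter> (*) k ` rough_numbers k = {}"
    using assms by (auto simp: rough_numbers_def)
qed

lemma powr_neg_summable_on:
  assumes "(1 :: real) < r"
  shows "(\<lambda>n::nat. real n powr - r) summable_on A"
  by (rule summable_on_subset_banach[of _ UNIV])
     (use summable_powr_neg[OF assms] in \<open>auto simp: summable_on_UNIV_nonneg_real_iff\<close>)

lemma infsum_powr_UNIV:
  assumes "1 < r"
  shows "infsum (\<lambda>n. real n powr - r) UNIV = zeta r"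
proof -
  have "infsum (\<lambda>n. real n powr - r) UNIV = (\<Sum>n. real n powr - r)"
    using has_sum_infsum[OF powr_neg_summable_on[OF assms], THEN has_sum_imp_sums]
    by (simp add: sums_iff)
  \<comment> \<open>\<open>zeta\<close> starts at 1; the additional term \<open>0 powr - r\<close>
    is 0.\<close>
  also have "\<dots> = zeta r"
    using suminf_split_head[OF summable_powr_neg[OF assms]]
    by (simp add: zeta_def powr_minus_divide)
  finally show ?thesis .
qed

text \<open>Sieving out a prime \<open>k\<close> multiplies the sum by
  \<open>1 - k powr - r\<close>, which is \<open>exp (- prime_log r k)\<close>; other
  \<open>k\<close> change nothing.\<close>

lemma infsum_rough_numbers:
  assumes "1 < r"
  shows "infsum (\<lambda>n. real n powr - r) (rough_numbers k)
       = zeta r * exp (- (\<Sum>n<k. prime_log r n))"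
proof (induction k)
  case 0
  have "infsum (\<lambda>n. real n powr - r) (rough_numbers 0) = infsum (\<lambda>n. real n powr - r) UNIV"
    by (rule infsum_cong_neutral) (auto simp: rough_numbers_def)
  then show ?case by (simp add: infsum_powr_UNIV[OF assms])
next
  case (Suc k)
  let ?X = "\<lambda>n::nat. real n powr - r"
  show ?case
  proof (cases "prime k")
    case True
    have "infsum ?X ((*) k ` rough_numbers k) = infsum (?X \<circ> (*) k) (rough_numbers k)"
      using prime_gt_0_nat[OF True] by (intro infsum_reindex inj_onI) simp
    also have "\<dots> = ?X k * infsum ?X (rough_numbers k)"
      by (simp add: o_def powr_mult infsum_cmult_right')
    finally have "infsum ?X (rough_numbers k)
        = infsum ?X (rough_numbers (Suc k)) + ?X k * infsum ?X (rough_numbers k)"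
      using infsum_Un_disjoint[OF powr_neg_summable_on[OF assms] powr_neg_summable_on[OF assms]
          rough_numbers_Suc(2)[OF True]] rough_numbers_Suc(1)[OF True] by simp
    then have "infsum ?X (rough_numbers (Suc k)) = infsum ?X (rough_numbers k) * exp (- prime_log r k)"
      by (simp add: exp_neg_prime_log[OF assms True] algebra_simps)
    then show ?thesis by (simp add: Suc.IH exp_diff exp_minus field_simps)
  next
    case False
    then have "rough_numbers (Suc k) = rough_numbers k"
      by (auto simp: rough_numbers_def less_Suc_eq)
    with False Suc.IH show ?thesis by (simp add: prime_log_def)
  qed
qed

text \<open>A \<open>k\<close>-rough number other than 1 is at least \<open>k\<close>, so the sieved
  sums lie between 1 and 1 plus a vanishing tail. Their limit 1 is also
  \<open>zeta r * exp (- log_tail r 0)\<close>.\<close>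

lemma zeta_eq_exp_log_tail:
  assumes "1 < r"
  shows "1 / zeta r = exp (- log_tail r 0)"
proof -
  let ?X = "\<lambda>n::nat. real n powr - r"
  define Z where "Z k = infsum ?X (rough_numbers k)" for k
  note summable = powr_neg_summable_on[OF assms]
  have "Z k \<ge> 1" for k
  proof -
    have "1 = infsum ?X {1}" by simp
    also have "\<dots> \<le> Z k"
      unfolding Z_def by (rule infsum_mono_neutral[OF summable summable]) (auto simp: rough_numbers_def)
    finally show ?thesis .
  qed
  moreover have "Z k \<le> 1 + (\<Sum>n. ?X (n + k))" for k
  proof -
    have "Z k \<le> infsum ?X ({1} \<union> {k..})"
      unfolding Z_def
    proof (rule infsum_mono_neutral[OF summable summable])
      fix n assume n: "n \<in> rough_numbers k - ({1} \<union> {k..})"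
      then obtain q where "prime q" "q dvd n" using prime_factor_nat[of n] by auto
      moreover have "q < k" using n dvd_imp_le[OF \<open>q dvd n\<close>] by (auto simp: rough_numbers_def)
      ultimately show "?X n \<le> 0" using n by (auto simp: rough_numbers_def)
    qed auto
    \<comment> \<open>Removing \<open>{k..}\<close> from \<open>{1}\<close> keeps the union disjoint
      when \<open>k \<le> 1\<close>.\<close>
    also have "\<dots> = infsum ?X ({1} - {k..}) + infsum ?X {k..}"
      by (subst infsum_Un_disjoint[OF summable summable, symmetric]) (auto intro!: arg_cong[where f = "infsum _"])
    also have "infsum ?X ({1} - {k..}) \<le> infsum ?X {1}"
      by (rule infsum_mono_neutral[OF summable summable]) auto
    also have "infsum ?X {k..} = infsum (?X \<circ> (\<lambda>n. n + k)) UNIV"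
    proof -
      have "{k..} = (\<lambda>n. n + k) ` UNIV"
        by (auto simp: image_iff) (metis le_add_diff_inverse2)
      then show ?thesis by (simp add: infsum_reindex inj_on_def)
    qed
    also have "\<dots> = (\<Sum>n. ?X (n + k))"
    proof -
      have "(?X \<circ> (\<lambda>n. n + k)) summable_on UNIV"
        using summable_powr_neg[OF assms]
        by (simp add: o_def summable_on_UNIV_nonneg_real_iff summable_iff_shift[of ?X k] del: of_nat_add)
      from has_sum_infsum[OF this, THEN has_sum_imp_sums] show ?thesis
        by (simp add: sums_iff o_def)
    qed
    finally show ?thesis by simp
  qed
  moreover have "(\<lambda>k. 1 + (\<Sum>n. ?X (n + k))) \<longlonglongrightarrow> 1 + 0"
    by (intro tendsto_intros suminf_exist_split2 summable_powr_neg assms)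
  ultimately have "Z \<longlonglongrightarrow> 1"
    by (intro tendsto_sandwich[of "\<lambda>_. 1" Z _ "\<lambda>k. 1 + (\<Sum>n. ?X (n + k))"]) auto
  moreover have "Z \<longlonglongrightarrow> zeta r * exp (- (log_tail r 0 - 0))"
  proof -
    have "Z = (\<lambda>k. zeta r * exp (- (log_tail r 0 - log_tail r k)))"
    proof
      show "Z k = zeta r * exp (- (log_tail r 0 - log_tail r k))" for k
        using log_tail_eq[OF assms, of k] by (simp add: Z_def infsum_rough_numbers[OF assms])
    qed
    then show ?thesis
      by (simp only:) (intro tendsto_intros log_tail_tendsto_0 assms)
  qed
  ultimately have "zeta r * exp (- (log_tail r 0 - 0)) = 1"
    by (intro LIMSEQ_unique[of Z])
  then show ?thesis by (simp add: exp_minus field_simps)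
qed

section \<open>The range of the arithmetic function\<close>

lemma alternating_sum_Suc:
  fixes x :: real
  shows "(\<Sum>j=0..Suc n. (- x) ^ j) = 1 - x * (\<Sum>j=0..n. (- x) ^ j)"
  by (simp only: sum.atLeast0_atMost_Suc_shift o_def power_Suc power_0 mult_minus_left sum_negf diff_conv_add_uminus
      flip: sum_distrib_left)

text \<open>Each sum arises from the previous one by \<open>y \<mapsto> 1 - x * y\<close>, which
  maps the interval from \<open>1 - x\<close> to 1 into itself.\<close>

lemma alternating_sum_bounds:
  fixes x :: real
  assumes "0 \<le> x" "x \<le> 1"
  shows "1 - x \<le> (\<Sum>j=0..n. (- x) ^ j)" "(\<Sum>j=0..n. (- x) ^ j) \<le> 1"
proof -
  have "1 - x \<le> (\<Sum>j=0..n. (- x) ^ j) \<and> (\<Sum>j=0..n. (- x) ^ j) \<le> 1"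
  proof (induction n)
    case (Suc n)
    then have "0 \<le> (\<Sum>j=0..n. (- x) ^ j)" using assms by linarith
    then have "0 \<le> x * (\<Sum>j=0..n. (- x) ^ j)" using assms by simp
    moreover have "x * (\<Sum>j=0..n. (- x) ^ j) \<le> x * 1"
      using Suc assms by (intro mult_left_mono) auto
    ultimately show ?case unfolding alternating_sum_Suc by linarith
  qed (use assms in auto)
  then show "1 - x \<le> (\<Sum>j=0..n. (- x) ^ j)" "(\<Sum>j=0..n. (- x) ^ j) \<le> 1" by auto
qed

text \<open>The lower bound \<open>1 - x\<close> is put into the recursion. Equality holds at
  \<open>n = 2\<close>, which is how squares of primes enter the theorem.\<close>

lemma alternating_sum_le:
  fixes x :: real
  assumes "0 \<le> x" "x \<le> 1" "n > 0"
  shows "(\<Sum>j=0..n. (- x) ^ j) \<le> 1 - x + x\<^sup>2"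
proof -
  obtain m where m: "n = Suc m" using assms(3) by (cases n) auto
  have "x * (1 - x) \<le> x * (\<Sum>j=0..m. (- x) ^ j)"
    using assms alternating_sum_bounds(1) by (intro mult_left_mono) auto
  then show ?thesis
    unfolding m alternating_sum_Suc by (simp add: right_diff_distrib power2_eq_square)
qed

lemma s_prime:
  assumes "prime p"
  shows "s t p = 1 - real p powr t"
  using s_prime_power[OF assms, of 1 t] by simp

lemma s_prime_square:
  assumes "prime p"
  shows "s t (p ^ 2) = 1 - real p powr t + (real p powr t)\<^sup>2"
  using s_prime_power[OF assms, of 2 t] by (simp add: numeral_2_eq_2)

text \<open>The other factors are at most 1, so a single prime divisor \<open>q\<close> already
  makes \<open>- ln s\<close> at least v_q.\<close>

lemma s_le_if_prime_dvd:
  assumes "1 < r" "n > 0" "prime q" "q dvd n"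
  shows "s (- r) n \<le> 1 - real q powr - r + (real q powr - r)\<^sup>2"
proof -
  let ?f = "\<lambda>p. \<Sum>j=0..multiplicity p n. (- (real p powr - r)) ^ j"
  have q: "q \<in> prime_factors n" using assms by (simp add: prime_factors_dvd)
  have f: "0 \<le> ?f p \<and> ?f p \<le> 1" if "p \<in> prime_factors n" for p
  proof -
    have "0 < real p powr - r" "real p powr - r < 1 / 2"
      using prime_powr_bounds[OF assms(1)] in_prime_factors_imp_prime[OF that] by blast+
    then show ?thesis
      using alternating_sum_bounds[of "real p powr - r" "multiplicity p n"] by linarith
  qed
  have "s (- r) n = ?f q * (\<Prod>p\<in>prime_factors n - {q}. ?f p)"
    unfolding s_def by (rule prod.remove) (use q in auto)
  also have "\<dots> \<le> ?f q * 1"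
    using f q by (intro mult_left_mono prod_le_1) auto
  also have "?f q * 1 \<le> 1 - real q powr - r + (real q powr - r)\<^sup>2"
    using alternating_sum_le[of "real q powr - r" "multiplicity q n"]
      prime_powr_bounds[OF assms(1,3)] q
    by (simp add: prime_factors_multiplicity)
  finally show ?thesis .
qed

text \<open>Whatever its exponent, a prime \<open>q\<close> contributes a factor of at least
  \<open>1 - q powr - r\<close>, that is, at most u_q to \<open>- ln s\<close>.\<close>

lemma s_ge_exp_log_tail:
  assumes "1 < r" "\<And>q. prime q \<Longrightarrow> q dvd n \<Longrightarrow> k \<le> q"
  shows "exp (- log_tail r k) \<le> s (- r) n"
proof -
  have "exp (- log_tail r k) \<le> exp (- (\<Sum>q\<in>prime_factors n. prime_log r q))"
    using sum_prime_log_le_log_tail[OF assms(1), of "prime_factors n" k] assms(2)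
    by (simp add: in_prime_factors_imp_dvd in_prime_factors_imp_prime)
  also have "\<dots> = (\<Prod>q\<in>prime_factors n. exp (- prime_log r q))"
    by (simp add: exp_sum flip: sum_negf)
  also have "\<dots> \<le> s (- r) n"
    unfolding s_def
  proof (rule prod_mono)
    fix q assume "q \<in> prime_factors n"
    then have q: "prime q" by auto
    show "0 \<le> exp (- prime_log r q) \<and>
      exp (- prime_log r q) \<le> (\<Sum>j=0..multiplicity q n. (- (real q powr - r)) ^ j)"
      using alternating_sum_bounds(1)[of "real q powr - r"] prime_powr_bounds[OF assms(1) q]
      by (simp add: exp_neg_prime_log[OF assms(1) q] del: exp_minus)
  qed
  finally show ?thesis .
qed

text \<open>If T_p < v_p, no value lies strictly between \<open>exp (- v_p)\<close> and
  \<open>exp (- T_p)\<close>: a prime divisor up to \<open>p\<close> forces a value to the lower end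
  or below, and without one it is at the upper end or above.\<close>

lemma dense_imp_gap_closed:
  assumes "1 < r" "prime p"
    and dense: "{1 / zeta r <.. 1} \<subseteq> closure {s (- r) n | n. n > 0}"
  shows "exp (- log_tail r (Suc p)) \<le> 1 - real p powr - r + (real p powr - r)\<^sup>2"
proof (rule ccontr)
  let ?S = "{s (- r) n | n. n > 0}"
  let ?v = "\<lambda>q. 1 - real q powr - r + (real q powr - r)\<^sup>2"
  assume neg: "\<not> ?thesis"
  \<comment> \<open>The gap is cut off at \<open>1 / zeta r\<close>, since density only concerns
    points above that.\<close>
  define a where "a = max (?v p) (exp (- log_tail r 0))"
  define b where "b = exp (- log_tail r (Suc p))"
  have "a < b"
    using neg log_tail_less[OF assms(1,2)] by (simp add: a_def b_def)
  have "{a<..<b} \<inter> ?S = {}"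
  proof safe
    fix n :: nat assume n: "n > 0" "s (- r) n \<in> {a<..<b}"
    then obtain q where q: "prime q" "q dvd n" "q \<le> p"
      using s_ge_exp_log_tail[OF assms(1), of n "Suc p"] unfolding b_def
      by (metis greaterThanLessThan_iff not_less_eq_eq not_le)
    have "real p powr - r \<le> real q powr - r"
      using q prime_gt_0_nat[OF q(1)] assms(1) by (intro powr_mono2') auto
    moreover have "real p powr - r + real q powr - r < 1"
      using prime_powr_bounds(2)[OF assms(1,2)] prime_powr_bounds(2)[OF assms(1) q(1)] by linarith
    \<comment> \<open>The product is \<open>?v p - ?v q\<close>, so the upper bound grows with the
      prime.\<close>
    ultimately have "0 \<le> (real q powr - r - real p powr - r) * (1 - (real p powr - r + real q powr - r))"
      by (intro mult_nonneg_nonneg) auto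
    then have "?v q \<le> ?v p" by (simp add: algebra_simps power2_eq_square)
    with s_le_if_prime_dvd[OF assms(1) n(1) q(1,2)] n(2) show "s (- r) n \<in> {}"
      by (simp add: a_def)
  qed
  then have "{a<..<b} \<inter> closure ?S = {}"
    by (simp add: open_Int_closure_eq_empty)
  moreover have "(a + b) / 2 \<in> {a<..<b}" using \<open>a < b\<close> by simp
  moreover have "(a + b) / 2 \<in> {1 / zeta r <.. 1}"
  proof -
    have "b \<le> 1" using log_tail_nonneg[OF assms(1)] by (simp add: b_def)
    moreover have "1 / zeta r \<le> a" by (simp add: a_def zeta_eq_exp_log_tail[OF assms(1)])
    ultimately show ?thesis using \<open>a < b\<close> by simp
  qed
  ultimately show False using dense by blast
qed

text \<open>The exponents \<open>0\<close>, \<open>2\<close>, \<open>3\<close>, \<open>1\<close>, in this order, move the target down by increasing amounts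
  whose successive differences are at most \<open>T\<close>: for the first one this is the hypothesis, and it
  implies the other two since \<open>x\<^sup>2 \<le> x - x\<^sup>2 \<le> T\<close>.\<close>

lemma exists_exponent:
  fixes x t T :: real
  assumes x: "0 < x" "x < 1 / 2" and T: "exp (- T) \<le> 1 - x + x\<^sup>2"
    and t: "0 \<le> t" "t \<le> T - ln (1 - x)"
  shows "\<exists>n. 0 \<le> t + ln (\<Sum>j=0..n. (- x) ^ j) \<and> t + ln (\<Sum>j=0..n. (- x) ^ j) \<le> T"
proof -
  define A where "A n = (\<Sum>j=0..n. (- x) ^ j)" for n :: nat
  have A: "A 0 = 1" "A 1 = 1 - x" "A 2 = 1 - x + x\<^sup>2" "A 3 = (1 - x) * (1 + x\<^sup>2)"
    by (simp_all add: A_def eval_nat_numeral algebra_simps)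
  have pos12: "1 - x > 0" "1 + x\<^sup>2 > 0" using x by (auto intro: add_pos_nonneg)
  then have pos: "1 - x > 0" "1 + x\<^sup>2 > 0" "A 3 > 0" "A 2 > 0"
    unfolding A(3,4) by (auto intro!: mult_pos_pos add_pos_nonneg)
  have sq: "x\<^sup>2 \<le> x - x\<^sup>2" using mult_left_mono[of x "1/2" x] x by (simp add: power2_eq_square)
  have v: "- ln (A 2) \<le> T"
    using T pos(4) unfolding A(3)[symmetric] by (metis ln_exp ln_mono exp_gt_zero minus_le_iff)
  have "ln (A 2) \<le> A 2 - 1" using pos(4) by (rule ln_le_minus_one)
  with v sq have xT: "x\<^sup>2 \<le> T" unfolding A(3) by linarith
  have "ln (A 3) = ln (1 - x) + ln (1 + x\<^sup>2)"
    unfolding A(4) using pos by (intro ln_mult_pos) auto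
  moreover have "ln (1 + x\<^sup>2) \<le> x\<^sup>2" by (rule ln_add_one_self_le_self) simp
  ultimately have u: "ln (A 3) - ln (A 1) \<le> T" using xT unfolding A(2) by linarith
  have "ln (A 2) - ln (A 3) = ln (A 2 / A 3)" using pos by (simp add: ln_div)
  also have "\<dots> \<le> A 2 / A 3 - 1" using pos by (intro ln_le_minus_one divide_pos_pos)
  also have "\<dots> \<le> x\<^sup>2"
  proof -
    \<comment> \<open>\<open>A 2 - A 3\<close> is \<open>x ^ 3\<close>, and
      \<open>x ^ 3 \<le> x\<^sup>2 * (1 - x) \<le> x\<^sup>2 * A 3\<close>.\<close>
    have "x\<^sup>2 * (1 - x) \<ge> x\<^sup>2 * x" using x by (intro mult_left_mono) auto
    moreover have "x\<^sup>2 * (1 - x) * 1 \<le> x\<^sup>2 * (1 - x) * (1 + x\<^sup>2)"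
      using x by (intro mult_left_mono) auto
    ultimately have "A 2 \<le> A 3 + x\<^sup>2 * A 3"
      unfolding A(3,4) by (simp add: algebra_simps power2_eq_square)
    then show ?thesis using pos(3) by (simp add: field_simps)
  qed
  finally have w: "ln (A 2) - ln (A 3) \<le> T" using xT by simp
  consider "t \<le> T" | "T < t" "t \<le> T - ln (A 2)" | "T - ln (A 2) < t" "t \<le> T - ln (A 3)"
    | "T - ln (A 3) < t" by linarith
  then have "\<exists>n. 0 \<le> t + ln (A n) \<and> t + ln (A n) \<le> T"
  proof cases
    case 1 then show ?thesis using t A(1) by (intro exI[of _ 0]) simp
  next
    case 2 then show ?thesis using v by (intro exI[of _ 2]) linarith
  next
    case 3 then show ?thesis using w by (intro exI[of _ 3]) linarith
  next
    case 4
    moreover have "t \<le> T - ln (A 1)" using t(2) A(2) by simp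
    ultimately show ?thesis using u by (intro exI[of _ 1]) linarith
  qed
  then show ?thesis by (simp add: A_def)
qed

text \<open>Greedy invariant: \<open>t + ln (s (- r) n)\<close> is what remains of the target after
  the primes below \<open>k\<close>, and it stays within what the primes from \<open>k\<close> on
  can still supply.\<close>

lemma approximate_log_s:
  assumes r: "1 < r"
    and gaps: "\<And>p. prime p \<Longrightarrow> exp (- log_tail r (Suc p)) \<le> 1 - real p powr - r + (real p powr - r)\<^sup>2"
    and t: "0 \<le> t" "t \<le> log_tail r 0"
  shows "\<exists>n>0. (\<forall>q. prime q \<longrightarrow> q dvd n \<longrightarrow> q < k) \<and> 0 < s (- r) n \<and>
    0 \<le> t + ln (s (- r) n) \<and> t + ln (s (- r) n) \<le> log_tail r k"
proof (induction k)
  case 0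
  show ?case using t s_1[of "- r"] by (intro exI[of _ 1]) (auto simp: prime_nat_iff)
next
  case (Suc k)
  then obtain n where n: "n > 0" "\<And>q. prime q \<Longrightarrow> q dvd n \<Longrightarrow> q < k" "0 < s (- r) n"
    "0 \<le> t + ln (s (- r) n)" "t + ln (s (- r) n) \<le> log_tail r k" by blast
  show ?case
  proof (cases "prime k")
    case True
    define x where "x = real k powr - r"
    have x: "0 < x" "x < 1 / 2" using prime_powr_bounds[OF r True] by (auto simp: x_def)
    have "t + ln (s (- r) n) \<le> log_tail r (Suc k) - ln (1 - x)"
      using n(5) log_tail_Suc[OF r, of k] True by (simp add: prime_log_def x_def)
    with exists_exponent[OF x, of "log_tail r (Suc k)" "t + ln (s (- r) n)"] gaps[OF True] n(4)
    obtain e where e: "0 \<le> t + ln (s (- r) n) + ln (\<Sum>j=0..e. (- x) ^ j)"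
      "t + ln (s (- r) n) + ln (\<Sum>j=0..e. (- x) ^ j) \<le> log_tail r (Suc k)"
      unfolding x_def by blast
    have se: "s (- r) (k ^ e) = (\<Sum>j=0..e. (- x) ^ j)"
      using s_prime_power[OF True, of e "- r"] s_1[of "- r"] by (cases "e = 0") (auto simp: x_def)
    have "\<not> k dvd n" using n(2)[OF True] by auto
    then have "coprime n (k ^ e)"
      using True by (simp add: prime_imp_coprime coprime_commute)
    then have s_mult: "s (- r) (n * k ^ e) = s (- r) n * s (- r) (k ^ e)"
      using n(1) prime_gt_0_nat[OF True] by (intro s_mult_coprime) auto
    have pos: "s (- r) (k ^ e) > 0"
      unfolding se using alternating_sum_bounds(1)[of x e] x by linarith
    have "ln (s (- r) (n * k ^ e)) = ln (s (- r) n) + ln (s (- r) (k ^ e))"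
      unfolding s_mult using n(3) pos by (rule ln_mult_pos)
    moreover have "q < Suc k" if "prime q" "q dvd n * k ^ e" for q
    proof -
      from that have "q dvd n \<or> q dvd k" by (auto simp: prime_dvd_mult_iff dest: prime_dvd_power)
      then show ?thesis using n(2) that(1) True by (auto simp: less_Suc_eq dest: primes_dvd_imp_eq)
    qed
    ultimately show ?thesis
      using e n(1,3) pos prime_gt_0_nat[OF True] unfolding se[symmetric]
      by (intro exI[of _ "n * k ^ e"]) (auto simp: s_mult)
  next
    case False
    then have "log_tail r (Suc k) = log_tail r k"
      using log_tail_Suc[OF r, of k] by (simp add: prime_log_def)
    then show ?thesis using n by (intro exI[of _ n]) (auto intro: less_SucI)
  qed
qed

text \<open>The greedy remainders are squeezed to 0 by \<open>log_tail r k\<close>.\<close>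

lemma gaps_closed_imp_dense:
  assumes r: "1 < r"
    and gaps: "\<And>p. prime p \<Longrightarrow> exp (- log_tail r (Suc p)) \<le> 1 - real p powr - r + (real p powr - r)\<^sup>2"
  shows "{1 / zeta r <.. 1} \<subseteq> closure {s (- r) n | n. n > 0}"
proof
  fix y assume y: "y \<in> {1 / zeta r <.. 1}"
  define t where "t = - ln y"
  have less: "exp (- log_tail r 0) < y" using y by (simp add: zeta_eq_exp_log_tail[OF r])
  then have "y > 0" by (rule less_trans[OF exp_gt_zero])
  moreover from this have "- log_tail r 0 \<le> ln y" using less by (simp add: ln_ge_iff)
  ultimately have t: "0 \<le> t" "t \<le> log_tail r 0" "y = exp (- t)"
    using y by (auto simp: t_def)
  from approximate_log_s[OF r gaps t(1,2)]
  have "\<forall>k. \<exists>n>0. 0 < s (- r) n \<and> 0 \<le> t + ln (s (- r) n) \<and> t + ln (s (- r) n) \<le> log_tail r k"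
    by blast
  then obtain N where N: "\<And>k. N k > 0" "\<And>k. 0 < s (- r) (N k)" "\<And>k. 0 \<le> t + ln (s (- r) (N k))"
    "\<And>k. t + ln (s (- r) (N k)) \<le> log_tail r k" by metis
  have "(\<lambda>k. t + ln (s (- r) (N k))) \<longlonglongrightarrow> 0"
    by (rule tendsto_sandwich[OF _ _ tendsto_const log_tail_tendsto_0[OF r]]) (use N in auto)
  then have "(\<lambda>k. exp (t + ln (s (- r) (N k)) - t)) \<longlonglongrightarrow> exp (0 - t)"
    by (intro tendsto_intros)
  then have "(\<lambda>k. s (- r) (N k)) \<longlonglongrightarrow> y" using N(2) t(3) by simp
  then show "y \<in> closure {s (- r) n | n. n > 0}"
    unfolding closure_sequential using N(1) by (intro exI[of _ "\<lambda>k. s (- r) (N k)"]) auto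
qed

text \<open>As \<open>p / q < 1\<close> and \<open>r \<le> 2\<close>,
  \<open>q powr - r \<ge> x * (p / q)\<^sup>2\<close> for \<open>x = p powr - r\<close>. Summing
  over \<open>Q\<close> gives T_p \<ge> x, and
  \<open>exp (- x) \<le> 1 / (1 + x) \<le> 1 - x + x\<^sup>2\<close>.\<close>

lemma gap_closed_5_or_ge_11:
  assumes r: "1 < r" "r \<le> 2" and p: "prime p" "p = 5 \<or> p \<ge> 11"
  shows "exp (- log_tail r (Suc p)) \<le> 1 - real p powr - r + (real p powr - r)\<^sup>2"
proof -
  define x where "x = real p powr - r"
  have x: "0 < x" using prime_powr_bounds(1)[OF r(1) p(1)] by (simp add: x_def)
  obtain Q where Q: "finite Q" "\<And>q. q \<in> Q \<Longrightarrow> prime q \<and> p < q"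
    "1 \<le> (\<Sum>q\<in>Q. (real p / real q)\<^sup>2)"
    using sum_prime_squares_above[OF p(2)] by blast
  have p0: "real p > 0" using prime_gt_0_nat[OF p(1)] by simp
  have "x \<le> x * (\<Sum>q\<in>Q. (real p / real q)\<^sup>2)"
    using mult_left_mono[OF Q(3), of x] x by simp
  also have "\<dots> \<le> (\<Sum>q\<in>Q. prime_log r q)"
    unfolding sum_distrib_left
  proof (rule sum_mono)
    fix q assume q: "q \<in> Q"
    then have pq: "real p < real q" "prime q" using Q(2) by auto
    have "(real p / real q)\<^sup>2 = (real p / real q) powr 2" using pq p0 by simp
    also have "\<dots> \<le> (real p / real q) powr r"
      using pq p0 r by (intro powr_mono') auto
    finally have "x * (real p / real q)\<^sup>2 \<le> x * (real p / real q) powr r"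
      using x by simp
    also have "\<dots> = real q powr - r"
      using p0 pq by (simp add: x_def powr_divide powr_minus field_simps)
    also have "\<dots> \<le> prime_log r q" by (rule prime_log_ge[OF r(1) pq(2)])
    finally show "x * (real p / real q)\<^sup>2 \<le> prime_log r q" .
  qed
  also have "\<dots> \<le> log_tail r (Suc p)"
    using Q by (intro sum_prime_log_le_log_tail r) (auto simp: Suc_le_eq)
  finally have "exp (- log_tail r (Suc p)) \<le> inverse (exp x)" by (simp flip: exp_minus)
  also have "\<dots> \<le> inverse (1 + x)" using x by (intro le_imp_inverse_le exp_ge_add_one_self) auto
  also have "\<dots> \<le> 1 - x + x\<^sup>2"
  proof -
    \<comment> \<open>The product equals \<open>1 + x ^ 3\<close>.\<close>
    have "1 \<le> (1 - x + x\<^sup>2) * (1 + x)" using x by (simp add: algebra_simps power2_eq_square)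
    then show ?thesis using x by (simp add: inverse_eq_divide pos_divide_le_eq)
  qed
  finally show ?thesis by (simp add: x_def)
qed

section \<open>Enumeration of the primes\<close>

lemma prime_nth_prime: "prime (nth_prime m)"
  using enumerate_in_set[OF primes_infinite] by (auto simp: nth_prime_def)

lemma nth_prime_Suc_eqI:
  assumes "nth_prime m = p" "m > 0" "prime q" "p < q" "\<And>n. p < n \<Longrightarrow> n < q \<Longrightarrow> \<not> prime n"
  shows "nth_prime (Suc m) = q"
proof -
  have "nth_prime (Suc m) = (LEAST n. n \<in> {p. prime p} \<and> p < n)"
    using assms(1,2) enumerate_Suc''[OF primes_infinite, of "m - 1"] by (simp add: nth_prime_def)
  also have "\<dots> = q"
    using assms(3-5) by (intro Least_equality) (auto simp: not_less[symmetric])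
  finally show ?thesis .
qed

lemma nth_prime_values: "nth_prime 1 = 2" "nth_prime 2 = 3" "nth_prime 4 = 7"
proof -
  show 1: "nth_prime 1 = 2"
    by (auto simp: nth_prime_def enumerate_0 intro!: Least_equality prime_ge_2_nat)
  show 2: "nth_prime 2 = 3"
    unfolding numeral_2_eq_2 by (rule nth_prime_Suc_eqI[OF 1[unfolded One_nat_def]]) simp_all
  have not4: "\<not> prime (4::nat)" "\<not> prime (6::nat)" by simp_all
  have "nth_prime (Suc 2) = 5"
  proof (rule nth_prime_Suc_eqI[OF 2])
    fix n :: nat assume "3 < n" "n < 5"
    then have "n = 4" by simp
    with not4 show "\<not> prime n" by simp
  qed simp_all
  then have "nth_prime (Suc (Suc 2)) = 7"
  proof (rule nth_prime_Suc_eqI)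
    fix n :: nat assume "5 < n" "n < 7"
    then have "n = 6" by simp
    with not4 show "\<not> prime n" by simp
  qed simp_all
  then show "nth_prime 4 = 7" by (simp add: numeral_eq_Suc)
qed

text \<open>The product runs over indices of primes, the series over all naturals; deleting the zero
  terms at non-primes matches them.\<close>

lemma prodinf_s_nth_prime:
  assumes r: "1 < r" and m: "m > 0"
  shows "(\<Prod>i. s (- r) (nth_prime (m + 1 + i))) = exp (- log_tail r (Suc (nth_prime m)))"
proof -
  define P where "P = {p::nat. prime p}"
  define p where "p = nth_prime m"
  have inf: "infinite P" unfolding P_def by (rule primes_infinite)
  \<comment> \<open>The positions of the later primes in the series shifted by \<open>Suc p\<close>.
    As \<open>nth_prime\<close> counts from 1, \<open>enumerate P (m + i)\<close> is
    \<open>nth_prime (m + 1 + i)\<close>.\<close>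
  define g where "g i = enumerate P (m + i) - Suc p" for i
  have p: "p = enumerate P (m - 1)" by (simp add: p_def nth_prime_def P_def)
  have g: "g i + Suc p = nth_prime (m + 1 + i)" for i
  proof -
    have "p < enumerate P (m + i)"
      unfolding p using m inf by (intro enumerate_mono) auto
    then show ?thesis by (simp add: g_def nth_prime_def P_def)
  qed
  have mono: "strict_mono g"
  proof (rule strict_monoI)
    fix i j :: nat assume "i < j"
    then have "enumerate P (m + i) < enumerate P (m + j)" using inf by (intro enumerate_mono) auto
    then have "g i + Suc p < g j + Suc p" unfolding g by (simp add: nth_prime_def P_def)
    then show "g i < g j" by simp
  qed
  have zero: "prime_log r (n + Suc p) = 0" if "n \<notin> range g" for n
  proof -
    have "\<not> prime (n + Suc p)"
    proof
      assume "prime (n + Suc p)"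
      then obtain j where j: "enumerate P j = n + Suc p"
        using enumerate_Ex[OF inf] unfolding P_def by blast
      then have "enumerate P (m - 1) < enumerate P j" unfolding p[symmetric] by simp
      then have "m - 1 < j" using inf by (simp add: enumerate_mono_iff)
      then have "m + (j - m) = j" by simp
      then have "g (j - m) = n" unfolding g_def by (simp add: j)
      with that show False by auto
    qed
    then show ?thesis by (simp add: prime_log_def)
  qed
  have "summable (\<lambda>n. prime_log r (n + Suc p))"
    using summable_prime_log[OF r] by (subst summable_iff_shift)
  then have "(\<lambda>n. prime_log r (n + Suc p)) sums log_tail r (Suc p)"
    unfolding log_tail_def by (rule summable_sums)
  then have "(\<lambda>i. prime_log r (g i + Suc p)) sums log_tail r (Suc p)"
    using sums_mono_reindex[of g "\<lambda>n. prime_log r (n + Suc p)", OF mono zero] by blast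
  then have "(\<lambda>i. - prime_log r (nth_prime (m + 1 + i))) sums (- log_tail r (Suc p))"
    unfolding g by (rule sums_minus)
  then have "(\<Prod>i. exp (- prime_log r (nth_prime (m + 1 + i)))) = exp (- log_tail r (Suc p))"
    using prodinf_exp[of "\<lambda>i. - prime_log r (nth_prime (m + 1 + i))"] by (simp add: sums_iff)
  then show ?thesis
    by (simp add: p_def s_prime exp_neg_prime_log[OF r] prime_nth_prime del: exp_minus)
qed

theorem theorem2p3:
  fixes r :: real
  assumes "1 < r" and "r \<le> 2"
  shows "{1 / zeta r <.. 1} \<subseteq> closure {s (- r) n | n. n > 0} \<longleftrightarrow>
    (\<forall>m\<in>{1, 2, 4}. s (- r) (nth_prime m ^ 2) \<ge> (\<Prod>i. s (- r) (nth_prime (m + 1 + i))))"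
proof -
  define G where "G p \<longleftrightarrow> exp (- log_tail r (Suc p)) \<le> 1 - real p powr - r + (real p powr - r)\<^sup>2" for p
  have cond: "s (- r) (nth_prime m ^ 2) \<ge> (\<Prod>i. s (- r) (nth_prime (m + 1 + i))) \<longleftrightarrow> G (nth_prime m)"
    if "m > 0" for m
    unfolding G_def prodinf_s_nth_prime[OF assms(1) that] s_prime_square[OF prime_nth_prime] ..
  have "{1 / zeta r <.. 1} \<subseteq> closure {s (- r) n | n. n > 0} \<longleftrightarrow> (\<forall>p. prime p \<longrightarrow> G p)"
    using dense_imp_gap_closed[OF assms(1)] gaps_closed_imp_dense[OF assms(1)]
    unfolding G_def by blast
  also have "\<dots> \<longleftrightarrow> G 2 \<and> G 3 \<and> G 7"
  proof safe
    fix p :: nat assume G: "G 2" "G 3" "G 7" and p: "prime p"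
    show "G p"
    proof (cases "p = 5 \<or> p \<ge> 11")
      case True
      then show ?thesis unfolding G_def using gap_closed_5_or_ge_11[OF assms p] by blast
    next
      case False
      then have "p = 0 \<or> p = 1 \<or> p = 2 \<or> p = 3 \<or> p = 4 \<or> p = 6 \<or> p = 7 \<or> p = 8 \<or> p = 9 \<or> p = 10"
        by presburger
      with p have "p = 2 \<or> p = 3 \<or> p = 7" by auto
      with G show ?thesis by auto
    qed
  qed simp_all
  also have "\<dots> \<longleftrightarrow> (\<forall>m\<in>{1, 2, 4}. G (nth_prime m))"
    by (simp only: ball_simps nth_prime_values) simp
  also have "\<dots> \<longleftrightarrow>
    (\<forall>m\<in>{1, 2, 4}. s (- r) (nth_prime m ^ 2) \<ge> (\<Prod>i. s (- r) (nth_prime (m + 1 + i))))"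
    by (intro ball_cong refl cond[symmetric]) auto
  finally show ?thesis .
qed

end
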